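(* Consider the system $$\begin{aligned} \frac{dx}{dt} &=\frac{2x^2y-x^2+(\alpha_0+\alpha_1)x+2\alpha_3z+2z^2w}{t}+1,\\ \frac{dy}{dt} &=\frac{-2xy^2+2xy-(\alpha_0+\alpha_1)y+\alpha_1}{t},\\ \frac{dz}{dt} &=\frac{2z^2w-z^2+(\alpha_0+\alpha_1+2\alpha_2+2\alpha_3)z+2yz^2}{t}+1,\\ \frac{dw}{dt} &=\frac{-2zw^2+2zw-(\alpha_0+\alpha_1+2\alpha_2+2\alpha_3)w-2\alpha_3y-4yzw+\alpha_3}{t}, \end{aligned}$$ where $\alpha_0,\dots,\alpha_4$ are complex parameters with $\alpha_0+\alpha_1+2\alpha_2+2\alpha_3+2\alpha_4=1$. This system admits extended affine Weyl group symmetry of type $B_4^{(1)}$ as the group of its Bäcklund transformations, with generators $s_0,\dots,s_4,\pi_1,\pi_2$ defined as follows, with the notation $( * ):=(x,y,z,w,t;\alpha_0,\dots,\alpha_4)$: $$\begin{aligned} s_0: ( * ) &\to \left(x+\tfrac{\alpha_0}{y-1},y,z,w,t;-\alpha_0,\alpha_1,\alpha_2+\alpha_0,\alpha_3,\alpha_4\right),\\ s_1: ( * ) &\to \left(x+\tfrac{\alpha_1}{y},y,z,w,t;\alpha_0,-\alpha_1,\alpha_2+\alpha_1,\alpha_3,\alpha_4\right),\\ s_2: ( * ) &\to \left(x,y-\tfrac{\alpha_2}{x-z},z,w+\tfrac{\alpha_2}{x-z},t;\alpha_0+\alpha_2,\alpha_1+\alpha_2,-\alpha_2,\alpha_3+\alpha_2,\alpha_4\right),\\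 s_3: ( * ) &\to \left(x,y,z+\tfrac{\alpha_3}{w},w,t;\alpha_0,\alpha_1,\alpha_2+\alpha_3,-\alpha_3,\alpha_4+\alpha_3\right),\\ s_4: ( * ) &\to \left(x,y,z,w-\tfrac{2\alpha_4}{z}+\tfrac{t}{z^2},-t;\alpha_0,\alpha_1,\alpha_2,\alpha_3+2\alpha_4,-\alpha_4\right),\\ \pi_1: ( * ) &\to (-x,1-y,-z,-w,-t;\alpha_1,\alpha_0,\alpha_2,\alpha_3,\alpha_4),\\ \pi_2: ( * ) &\to \left(\tfrac{t}{z},-\tfrac{z}{t}(zw+\alpha_3),\tfrac{t}{x},-\tfrac{x}{t}(xy+\alpha_1),t;2\alpha_4+\alpha_3,\alpha_3,\alpha_2,\alpha_1,\tfrac{\alpha_0-\alpha_1}{2}\right). \end{aligned}$$ That is, each of these transformations is a Bäcklund transformation of the system, and they satisfy $s_i^2=1$ $(0\le i\le4)$, $\pi_1^2=\pi_2^2=1$, $(s_0s_1)^2=(s_0s_3)^2=(s_0s_4)^2=(s_1s_3)^2=(s_1s_4)^2=(s_2s_4)^2=1$, $(s_0s_2)^3=(s_1s_2)^3=(s_2s_3)^3=1$ and $(s_3s_4)^4=1$.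
   Context: A Bäcklund transformation of the system is a birational transformation $(x,y,z,w,t;\alpha)\to(\tilde x,\tilde y,\tilde z,\tilde w,\tilde t;\tilde\alpha)$ such that whenever $(x,y,z,w)$ solves the system with independent variable $t$ and parameters $\alpha$, the functions $(\tilde x,\tilde y,\tilde z,\tilde w)$ solve the same system with independent variable $\tilde t$ and parameters $\tilde\alpha$. The relations are understood as relations between birational transformations of $(x,y,z,w,t;\alpha_0,\dots,\alpha_4)$ subject to the parameter relation. The listed relations among $s_0,\dots,s_4$ are the Coxeter relations of the affine Weyl group $W(B_4^{(1)})$; "extended" refers to the additional generators $\pi_1,\pi_2$. *)

theory Defs
  imports "HOL-Analysis.Analysis"
begin

datatype point = Point
  (pt_x: complex) (pt_y: complex) (pt_z: complex) (pt_w: complex) (pt_t: complex)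
  (pt_a0: complex) (pt_a1: complex) (pt_a2: complex) (pt_a3: complex) (pt_a4: complex)

definition coords :: "(point \<Rightarrow> complex) set" where
  "coords = {pt_x, pt_y, pt_z, pt_w, pt_t, pt_a0, pt_a1, pt_a2, pt_a3, pt_a4}"

text \<open>The parameter relation cuts out the irreducible affine variety (a hyperplane) on which
  the birational transformations live.\<close>

definition param_rel :: "complex \<Rightarrow> complex \<Rightarrow> complex \<Rightarrow> complex \<Rightarrow> complex \<Rightarrow> bool" where
  "param_rel a0 a1 a2 a3 a4 \<longleftrightarrow> a0 + a1 + 2 * a2 + 2 * a3 + 2 * a4 = 1"

definition phase_space :: "point set" where
  "phase_space = {p. param_rel (pt_a0 p) (pt_a1 p) (pt_a2 p) (pt_a3 p) (pt_a4 p)}"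

section \<open>Rational and birational maps\<close>

inductive polynomial_fun :: "(point \<Rightarrow> complex) \<Rightarrow> bool" where
  coord: "f \<in> coords \<Longrightarrow> polynomial_fun f"
| const: "polynomial_fun (\<lambda>p. c)"
| add: "polynomial_fun f \<Longrightarrow> polynomial_fun g \<Longrightarrow> polynomial_fun (\<lambda>p. f p + g p)"
| mult: "polynomial_fun f \<Longrightarrow> polynomial_fun g \<Longrightarrow> polynomial_fun (\<lambda>p. f p * g p)"

text \<open>A rational self-map of \<^const>\<open>phase_space\<close> is represented by a partial function that is regular
  on a nonempty principal Zariski-open set \<open>{p. d p \<noteq> 0}\<close>, which is its domain of definition there.
  One common denominator \<open>d\<close> is no restriction. The behaviour off \<^const>\<open>phase_space\<close> is
  irrelevant.\<close>

definition rational_map :: "(point \<rightharpoonup> point) \<Rightarrow> bool" where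
  "rational_map f \<longleftrightarrow>
    (\<exists>d. polynomial_fun d \<and>
         (\<exists>p\<in>phase_space. d p \<noteq> 0) \<and>
         phase_space \<inter> dom f = {p \<in> phase_space. d p \<noteq> 0} \<and>
         (\<forall>p\<in>phase_space. \<forall>q. f p = Some q \<longrightarrow> q \<in> phase_space) \<and>
         (\<forall>c\<in>coords. \<exists>n. polynomial_fun n \<and>
            (\<forall>p\<in>phase_space. \<forall>q. f p = Some q \<longrightarrow> c q = n p / d p)))"

text \<open>Equality of rational maps: both are defined and agree on a nonempty (hence dense) Zariski-open
  subset of \<^const>\<open>phase_space\<close>.\<close>

definition rat_eq :: "(point \<rightharpoonup> point) \<Rightarrow> (point \<rightharpoonup> point) \<Rightarrow> bool" (infix \<open>\<approx>\<close> 50) where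
  "f \<approx> g \<longleftrightarrow>
    (\<exists>d. polynomial_fun d \<and>
         (\<exists>p\<in>phase_space. d p \<noteq> 0) \<and>
         (\<forall>p\<in>phase_space. d p \<noteq> 0 \<longrightarrow> p \<in> dom f \<and> p \<in> dom g \<and> f p = g p))"

text \<open>The identity map is \<^const>\<open>Some\<close>; composition is composition of partial functions.\<close>

definition birational :: "(point \<rightharpoonup> point) \<Rightarrow> bool" where
  "birational f \<longleftrightarrow>
    rational_map f \<and> (\<exists>g. rational_map g \<and> (g \<circ>\<^sub>m f) \<approx> Some \<and> (f \<circ>\<^sub>m g) \<approx> Some)"

primrec map_power :: "('a \<rightharpoonup> 'a) \<Rightarrow> nat \<Rightarrow> ('a \<rightharpoonup> 'a)" where
  "map_power f 0 = Some"
| "map_power f (Suc n) = f \<circ>\<^sub>m map_power f n"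

section \<open>The system\<close>

fun rhs_x :: "point \<Rightarrow> complex" where
  "rhs_x (Point x y z w t a0 a1 a2 a3 a4) =
    (2 * x^2 * y - x^2 + (a0 + a1) * x + 2 * a3 * z + 2 * z^2 * w) / t + 1"

fun rhs_y :: "point \<Rightarrow> complex" where
  "rhs_y (Point x y z w t a0 a1 a2 a3 a4) =
    (- 2 * x * y^2 + 2 * x * y - (a0 + a1) * y + a1) / t"

fun rhs_z :: "point \<Rightarrow> complex" where
  "rhs_z (Point x y z w t a0 a1 a2 a3 a4) =
    (2 * z^2 * w - z^2 + (a0 + a1 + 2 * a2 + 2 * a3) * z + 2 * y * z^2) / t + 1"

fun rhs_w :: "point \<Rightarrow> complex" where
  "rhs_w (Point x y z w t a0 a1 a2 a3 a4) =
    (- 2 * z * w^2 + 2 * z * w - (a0 + a1 + 2 * a2 + 2 * a3) * w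
       - 2 * a3 * y - 4 * y * z * w + a3) / t"

text \<open>\<open>(X, Y, Z, W)\<close>, holomorphic on the open set \<open>D\<close>, solves the system with independent variable
  \<open>T\<close> and the given parameters. The independent variable is itself a function on \<open>D\<close>
  (a local coordinate: its derivative vanishes nowhere), and \<open>dX/dT\<close> is \<open>X'/T'\<close>. The ordinary
  notion of solution is the case \<open>T = (\<lambda>t. t)\<close>. Since \<open>T = 0\<close> is a singularity of the system, it is
  excluded.\<close>

definition solves ::
  "complex set \<Rightarrow> (complex \<Rightarrow> complex) \<Rightarrow> (complex \<Rightarrow> complex) \<Rightarrow> (complex \<Rightarrow> complex) \<Rightarrow>
   (complex \<Rightarrow> complex) \<Rightarrow> (complex \<Rightarrow> complex) \<Rightarrow>
   complex \<Rightarrow> complex \<Rightarrow> complex \<Rightarrow> complex \<Rightarrow> complex \<Rightarrow> bool" where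
  "solves D X Y Z W T a0 a1 a2 a3 a4 \<longleftrightarrow>
    open D \<and> param_rel a0 a1 a2 a3 a4 \<and>
    X holomorphic_on D \<and> Y holomorphic_on D \<and> Z holomorphic_on D \<and> W holomorphic_on D \<and>
    T holomorphic_on D \<and>
    (\<forall>s\<in>D. let p = Point (X s) (Y s) (Z s) (W s) (T s) a0 a1 a2 a3 a4 in
       T s \<noteq> 0 \<and> deriv T s \<noteq> 0 \<and>
       deriv X s / deriv T s = rhs_x p \<and>
       deriv Y s / deriv T s = rhs_y p \<and>
       deriv Z s / deriv T s = rhs_z p \<and>
       deriv W s / deriv T s = rhs_w p)"

text \<open>A solution is transformed wherever the transformation is defined along it; as \<open>D\<close> is an
  arbitrary open set, it may be shrunk to the open set of such points.\<close>

definition baecklund :: "(point \<rightharpoonup> point) \<Rightarrow> bool" where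
  "baecklund f \<longleftrightarrow> birational f \<and>
    (\<forall>D X Y Z W a0 a1 a2 a3 a4.
       solves D X Y Z W (\<lambda>t. t) a0 a1 a2 a3 a4 \<longrightarrow>
       (\<forall>t\<in>D. Point (X t) (Y t) (Z t) (W t) t a0 a1 a2 a3 a4 \<in> dom f) \<longrightarrow>
       (\<exists>X' Y' Z' W' T' b0 b1 b2 b3 b4.
          (\<forall>t\<in>D. f (Point (X t) (Y t) (Z t) (W t) t a0 a1 a2 a3 a4) =
                  Some (Point (X' t) (Y' t) (Z' t) (W' t) (T' t) b0 b1 b2 b3 b4)) \<and>
          solves D X' Y' Z' W' T' b0 b1 b2 b3 b4))"

section \<open>The generators\<close>

fun s0 :: "point \<rightharpoonup> point" where
  "s0 (Point x y z w t a0 a1 a2 a3 a4) =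
    (if y - 1 \<noteq> 0
     then Some (Point (x + a0 / (y - 1)) y z w t (- a0) a1 (a2 + a0) a3 a4)
     else None)"

fun s1 :: "point \<rightharpoonup> point" where
  "s1 (Point x y z w t a0 a1 a2 a3 a4) =
    (if y \<noteq> 0
     then Some (Point (x + a1 / y) y z w t a0 (- a1) (a2 + a1) a3 a4)
     else None)"

fun s2 :: "point \<rightharpoonup> point" where
  "s2 (Point x y z w t a0 a1 a2 a3 a4) =
    (if x - z \<noteq> 0
     then Some (Point x (y - a2 / (x - z)) z (w + a2 / (x - z)) t
                 (a0 + a2) (a1 + a2) (- a2) (a3 + a2) a4)
     else None)"

fun s3 :: "point \<rightharpoonup> point" where
  "s3 (Point x y z w t a0 a1 a2 a3 a4) =
    (if w \<noteq> 0
     then Some (Point x y (z + a3 / w) w t a0 a1 (a2 + a3) (- a3) (a4 + a3))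
     else None)"

fun s4 :: "point \<rightharpoonup> point" where
  "s4 (Point x y z w t a0 a1 a2 a3 a4) =
    (if z \<noteq> 0
     then Some (Point x y z (w - 2 * a4 / z + t / z^2) (- t) a0 a1 a2 (a3 + 2 * a4) (- a4))
     else None)"

fun pi1 :: "point \<rightharpoonup> point" where
  "pi1 (Point x y z w t a0 a1 a2 a3 a4) =
    Some (Point (- x) (1 - y) (- z) (- w) (- t) a1 a0 a2 a3 a4)"

fun pi2 :: "point \<rightharpoonup> point" where
  "pi2 (Point x y z w t a0 a1 a2 a3 a4) =
    (if x \<noteq> 0 \<and> z \<noteq> 0 \<and> t \<noteq> 0
     then Some (Point (t / z) (- (z / t) * (z * w + a3)) (t / x) (- (x / t) * (x * y + a1)) t
                 (2 * a4 + a3) a3 a2 a1 ((a0 - a1) / 2))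
     else None)"

end

theory Submission
  imports Defs
begin

text \<open>Every generator is given by explicit formulas and inverts itself wherever it is defined, so it
  is birational with itself as inverse. That it is a Baecklund transformation is then the chain rule: the
  derivative of each transformed coordinate is computed from the system and compared, as a rational
  function, with the right-hand side at the transformed point.

  For a group relation, two questions have to be separated: whether a word in the generators is
  defined at all on a nonempty Zariski-open set, and what its value is. The first has a general
  answer. The hyperplane \<^const>\<open>phase_space\<close> is irreducible
  (\<open>phase_space_irreducible\<close>), so finitely many generic conditions hold simultaneously at a generic
  point, and a birational map is dominant, so generic conditions pull back to generic conditions
  (\<open>generically_pullback\<close>). Hence every word in birational maps is generically defined, and no
  denominator of a long composition has to be written down.

  For the second, the relation \<open>(f g)\<^sup>m = 1\<close> between involutions says that the two alternating
  words of length \<open>m\<close> in \<open>f\<close> and \<open>g\<close> agree, since reversing one of them inverts it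
  (\<open>run_append_rev_is_identity\<close>). This halves the length of the compositions that must be
  evaluated. For \<open>m = 2\<close> the maps visibly commute; for \<open>m = 3\<close> and \<open>m = 4\<close> the identities needed are
  the rank-two computations \<open>braid_A2\<close> and \<open>braid_B2\<close> in an arbitrary field.\<close>

section \<open>Polynomial functions and irreducibility of the phase space\<close>

lemma polynomial_fun_coord:
  "polynomial_fun pt_x" "polynomial_fun pt_y" "polynomial_fun pt_z" "polynomial_fun pt_w"
  "polynomial_fun pt_t" "polynomial_fun pt_a0" "polynomial_fun pt_a1" "polynomial_fun pt_a2"
  "polynomial_fun pt_a3" "polynomial_fun pt_a4"
  by (auto intro!: polynomial_fun.coord simp: coords_def)

lemma polynomial_fun_uminus: "polynomial_fun f \<Longrightarrow> polynomial_fun (\<lambda>p. - f p)"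
  using polynomial_fun.mult[OF polynomial_fun.const[of "-1"], of f] by simp

lemma polynomial_fun_diff:
  "polynomial_fun f \<Longrightarrow> polynomial_fun g \<Longrightarrow> polynomial_fun (\<lambda>p. f p - g p)"
  using polynomial_fun.add[OF _ polynomial_fun_uminus, of f g] by simp

lemma polynomial_fun_divide_const: "polynomial_fun f \<Longrightarrow> polynomial_fun (\<lambda>p. f p / c)"
  using polynomial_fun.mult[OF _ polynomial_fun.const[of "inverse c"], of f]
  by (simp add: field_class.field_divide_inverse)

lemma polynomial_fun_power: "polynomial_fun f \<Longrightarrow> polynomial_fun (\<lambda>p. f p ^ n)"
  by (induction n) (auto intro: polynomial_fun.const polynomial_fun.mult)

lemmas polynomial_fun_intros =
  polynomial_fun_coord polynomial_fun.const polynomial_fun.add polynomial_fun.mult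
  polynomial_fun_uminus polynomial_fun_diff polynomial_fun_divide_const polynomial_fun_power

definition line :: "point \<Rightarrow> point \<Rightarrow> complex \<Rightarrow> point" where
  "line p q s = Point
     (pt_x p + s * (pt_x q - pt_x p)) (pt_y p + s * (pt_y q - pt_y p))
     (pt_z p + s * (pt_z q - pt_z p)) (pt_w p + s * (pt_w q - pt_w p))
     (pt_t p + s * (pt_t q - pt_t p))
     (pt_a0 p + s * (pt_a0 q - pt_a0 p)) (pt_a1 p + s * (pt_a1 q - pt_a1 p))
     (pt_a2 p + s * (pt_a2 q - pt_a2 p)) (pt_a3 p + s * (pt_a3 q - pt_a3 p))
     (pt_a4 p + s * (pt_a4 q - pt_a4 p))"

lemma line_0 [simp]: "line p q 0 = p" and line_1 [simp]: "line p q 1 = q"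
  by (simp_all add: line_def)

lemma line_in_phase_space:
  assumes "p \<in> phase_space" "q \<in> phase_space"
  shows "line p q s \<in> phase_space"
proof -
  let ?l = "\<lambda>r. pt_a0 r + pt_a1 r + 2 * pt_a2 r + 2 * pt_a3 r + 2 * pt_a4 r"
  have "?l (line p q s) = ?l p + s * (?l q - ?l p)"
    by (simp add: line_def algebra_simps)
  with assms show ?thesis
    by (simp add: phase_space_def param_rel_def)
qed

lemma polynomial_fun_on_line:
  assumes "polynomial_fun f"
  shows "\<exists>P. \<forall>s. f (line p q s) = poly P s"
  using assms
proof induction
  case (coord f)
  then have "f (line p q s) = poly [:f p, f q - f p:] s" for s
    by (auto simp: coords_def line_def)
  then show ?case by blast
next
  case (const c)
  have "c = poly [:c:] s" for s by simp
  then show ?case by blast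
next
  case (add f g)
  then show ?case by (metis poly_add)
next
  case (mult f g)
  then show ?case by (metis poly_mult)
qed

text \<open>A nonvanishing point of \<open>f\<close> and one of \<open>g\<close> are joined by a line inside the hyperplane. On that line
  both functions are nonzero polynomials in one variable, so their product has only finitely many
  zeros there.\<close>

lemma phase_space_irreducible:
  assumes "polynomial_fun f" "polynomial_fun g"
    and "p \<in> phase_space" "f p \<noteq> 0" and "q \<in> phase_space" "g q \<noteq> 0"
  shows "\<exists>r\<in>phase_space. f r * g r \<noteq> 0"
proof -
  obtain F G where F: "f (line p q s) = poly F s" and G: "g (line p q s) = poly G s" for s
    using polynomial_fun_on_line[OF assms(1)] polynomial_fun_on_line[OF assms(2)] by meson
  have "poly F 0 \<noteq> 0" "poly G 1 \<noteq> 0"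
    using F[of 0] G[of 1] assms by auto
  then have "F * G \<noteq> 0" by auto
  then obtain s where "poly (F * G) s \<noteq> 0"
    using poly_all_0_iff_0 by blast
  then have "f (line p q s) * g (line p q s) \<noteq> 0"
    by (simp add: F G)
  then show ?thesis
    using line_in_phase_space assms by blast
qed

section \<open>Generic points\<close>

definition generically :: "(point \<Rightarrow> bool) \<Rightarrow> bool" where
  "generically P \<longleftrightarrow>
    (\<exists>d. polynomial_fun d \<and> (\<exists>p\<in>phase_space. d p \<noteq> 0) \<and>
         (\<forall>p\<in>phase_space. d p \<noteq> 0 \<longrightarrow> P p))"

lemma rat_eq_iff_generically:
  "f \<approx> g \<longleftrightarrow> generically (\<lambda>p. p \<in> dom f \<and> p \<in> dom g \<and> f p = g p)"
  by (simp add: rat_eq_def generically_def)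

lemma generically_mono:
  assumes "generically P" "\<And>p. p \<in> phase_space \<Longrightarrow> P p \<Longrightarrow> Q p"
  shows "generically Q"
  using assms unfolding generically_def by meson

lemma generically_conj:
  assumes "generically P" "generically Q"
  shows "generically (\<lambda>p. P p \<and> Q p)"
proof -
  obtain d e where "polynomial_fun d" "\<exists>p\<in>phase_space. d p \<noteq> 0"
      "\<forall>p\<in>phase_space. d p \<noteq> 0 \<longrightarrow> P p"
      "polynomial_fun e" "\<exists>p\<in>phase_space. e p \<noteq> 0"
      "\<forall>p\<in>phase_space. e p \<noteq> 0 \<longrightarrow> Q p"
    using assms unfolding generically_def by auto
  then have "polynomial_fun (\<lambda>p. d p * e p)" "\<exists>p\<in>phase_space. d p * e p \<noteq> 0"
      "\<forall>p\<in>phase_space. d p * e p \<noteq> 0 \<longrightarrow> P p \<and> Q p"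
    using phase_space_irreducible by (auto intro: polynomial_fun.mult)
  then show ?thesis
    unfolding generically_def by blast
qed

lemma generically_True: "generically (\<lambda>p. True)"
proof -
  have "Point 0 0 0 0 0 1 0 0 0 0 \<in> phase_space"
    by (simp add: phase_space_def param_rel_def)
  then show ?thesis
    unfolding generically_def
    by (intro exI[of _ "\<lambda>p. 1"]) (auto intro: polynomial_fun.const)
qed

lemma generically_ex: "generically P \<Longrightarrow> \<exists>p\<in>phase_space. P p"
  unfolding generically_def by blast

text \<open>Substituting the fractions \<open>n / d\<close> for the coordinates in a polynomial and clearing denominators
  leaves a power of the common denominator \<open>d\<close>, whose exponent grows with the degree.\<close>

lemma polynomial_fun_pullback:
  assumes d: "polynomial_fun d" "phase_space \<inter> dom f = {p \<in> phase_space. d p \<noteq> 0}"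
    and coord: "\<forall>c\<in>coords. \<exists>n. polynomial_fun n \<and>
            (\<forall>p\<in>phase_space. \<forall>q. f p = Some q \<longrightarrow> c q = n p / d p)"
    and g: "polynomial_fun g"
  shows "\<exists>n k. polynomial_fun n \<and>
            (\<forall>p\<in>phase_space. \<forall>q. f p = Some q \<longrightarrow> g q = n p / d p ^ k)"
  using g
proof induction
  case (coord c)
  then obtain n where "polynomial_fun n"
      "\<forall>p\<in>phase_space. \<forall>q. f p = Some q \<longrightarrow> c q = n p / d p"
    using assms(3) by blast
  then show ?case by (intro exI[of _ n] exI[of _ 1]) auto
next
  case (const c)
  show ?case by (intro exI[of _ "\<lambda>p. c"] exI[of _ 0]) (auto intro: polynomial_fun.const)
next
  case (add g h)
  then obtain n k m l where n: "polynomial_fun n" "polynomial_fun m"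
      and eq: "\<forall>p\<in>phase_space. \<forall>q. f p = Some q \<longrightarrow> g q = n p / d p ^ k"
        "\<forall>p\<in>phase_space. \<forall>q. f p = Some q \<longrightarrow> h q = m p / d p ^ l"
    by meson
  have "g q + h q = (n p * d p ^ l + m p * d p ^ k) / d p ^ (k + l)"
    if p: "p \<in> phase_space" "f p = Some q" for p q
  proof -
    have "d p \<noteq> 0" using d(2) p by blast
    then show ?thesis using eq p by (simp add: power_add field_simps)
  qed
  moreover have "polynomial_fun (\<lambda>p. n p * d p ^ l + m p * d p ^ k)"
    by (intro polynomial_fun_intros n d)
  ultimately show ?case by blast
next
  case (mult g h)
  then obtain n k m l where n: "polynomial_fun n" "polynomial_fun m"
      and eq: "\<forall>p\<in>phase_space. \<forall>q. f p = Some q \<longrightarrow> g q = n p / d p ^ k"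
        "\<forall>p\<in>phase_space. \<forall>q. f p = Some q \<longrightarrow> h q = m p / d p ^ l"
    by meson
  have "g q * h q = (n p * m p) / d p ^ (k + l)"
    if "p \<in> phase_space" "f p = Some q" for p q
    using eq that by (simp add: power_add)
  moreover have "polynomial_fun (\<lambda>p. n p * m p)"
    by (intro polynomial_fun_intros n)
  ultimately show ?case by blast
qed

text \<open>The pulled-back condition holds off the zeros of a polynomial; the point is that this polynomial is
  not identically zero. It would be if the image of \<open>f\<close> lay in a proper closed subset, which the
  existence of a rational right inverse rules out.\<close>

lemma generically_pullback:
  assumes f: "birational f" and P: "generically P"
  shows "generically (\<lambda>p. \<exists>q\<in>phase_space. f p = Some q \<and> P q)"
proof -
  obtain d where d: "polynomial_fun d"
      and dom: "phase_space \<inter> dom f = {p \<in> phase_space. d p \<noteq> 0}"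
      and maps: "\<forall>p\<in>phase_space. \<forall>q. f p = Some q \<longrightarrow> q \<in> phase_space"
      and coord: "\<forall>c\<in>coords. \<exists>n. polynomial_fun n \<and>
            (\<forall>p\<in>phase_space. \<forall>q. f p = Some q \<longrightarrow> c q = n p / d p)"
    using f unfolding birational_def rational_map_def by (elim conjE exE) blast
  obtain h where h: "rational_map h" and inv: "(f \<circ>\<^sub>m h) \<approx> Some"
    using f unfolding birational_def by blast
  obtain e where e: "polynomial_fun e" and e0: "\<exists>p\<in>phase_space. e p \<noteq> 0"
      and eP: "\<And>p. p \<in> phase_space \<Longrightarrow> e p \<noteq> 0 \<Longrightarrow> P p"
    using P unfolding generically_def by auto
  obtain n k where n: "polynomial_fun n"
      and nk: "\<forall>p\<in>phase_space. \<forall>q. f p = Some q \<longrightarrow> e q = n p / d p ^ k"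
    using polynomial_fun_pullback[OF d dom coord e] by auto
  \<comment> \<open>The map \<open>f\<close> is dominant: a generic point \<open>p\<close> with \<open>e p \<noteq> 0\<close> is the image of \<open>h p\<close>.\<close>
  have "generically (\<lambda>p. e p \<noteq> 0 \<and> (f \<circ>\<^sub>m h) p = Some p)"
  proof (rule generically_conj)
    show "generically (\<lambda>p. e p \<noteq> 0)"
      using e e0 unfolding generically_def by blast
    show "generically (\<lambda>p. (f \<circ>\<^sub>m h) p = Some p)"
      using inv unfolding rat_eq_iff_generically by (rule generically_mono) simp
  qed
  then obtain p where p: "p \<in> phase_space" "e p \<noteq> 0" "(f \<circ>\<^sub>m h) p = Some p"
    using generically_ex by blast
  then obtain q where q: "h p = Some q" "f q = Some p"
    by (auto simp: map_comp_Some_iff)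
  have qs: "q \<in> phase_space"
    using h p(1) q(1) unfolding rational_map_def by blast
  have "d q \<noteq> 0"
    using dom qs q(2) by blast
  moreover have "n q \<noteq> 0"
    using nk qs q(2) p(2) by force
  ultimately have "\<exists>p\<in>phase_space. d p * n p \<noteq> 0"
    using qs by auto
  moreover have "\<exists>q\<in>phase_space. f p = Some q \<and> P q"
    if p: "p \<in> phase_space" "d p * n p \<noteq> 0" for p
  proof -
    have "p \<in> dom f" using dom p by auto
    then obtain q where q: "f p = Some q" by blast
    then have "q \<in> phase_space" "e q \<noteq> 0" using maps nk p by auto
    then show ?thesis using q eP by blast
  qed
  ultimately show ?thesis
    unfolding generically_def using polynomial_fun.mult[OF d n] by blast
qed

section \<open>Words in birational involutions\<close>

text \<open>The word is applied from left to right, so that its reversal inverts it when the letters are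
  involutions.\<close>

primrec run :: "('a \<rightharpoonup> 'a) list \<Rightarrow> ('a \<rightharpoonup> 'a)" where
  "run [] = Some"
| "run (f # fs) = run fs \<circ>\<^sub>m f"

lemma run_append: "run (fs @ gs) = run gs \<circ>\<^sub>m run fs"
  by (induction fs) (auto simp: map_comp_def fun_eq_iff split: option.splits)

text \<open>The equation is required at every point of \<open>S\<close> where \<open>f\<close> is defined. In contrast to
  \<open>f \<circ>\<^sub>m f \<approx> Some\<close> this allows a word to be undone letter by letter along an individual orbit.\<close>

definition involution_on :: "'a set \<Rightarrow> ('a \<rightharpoonup> 'a) \<Rightarrow> bool" where
  "involution_on S f \<longleftrightarrow> (\<forall>p\<in>S. \<forall>q. f p = Some q \<longrightarrow> q \<in> S \<and> f q = Some p)"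

lemma run_rev_involutions:
  assumes "\<And>f. f \<in> set fs \<Longrightarrow> involution_on S f" "p \<in> S" "run fs p = Some q"
  shows "q \<in> S \<and> run (rev fs) q = Some p"
  using assms
proof (induction fs arbitrary: p)
  case Nil
  then show ?case by simp
next
  case (Cons f fs)
  then obtain r where r: "f p = Some r" "run fs r = Some q"
    by (auto simp: map_comp_Some_iff)
  then have "r \<in> S" "f r = Some p"
    using Cons.prems unfolding involution_on_def by auto
  then show ?case
    using Cons.IH[of r] Cons.prems r by (auto simp: run_append map_comp_def)
qed

lemma generically_run_defined:
  assumes "\<And>f. f \<in> set fs \<Longrightarrow> birational f"
  shows "generically (\<lambda>p. run fs p \<noteq> None)"
  using assms
proof (induction fs)
  case Nil
  show ?case by (simp add: generically_True)
next
  case (Cons f fs)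
  then have "generically (\<lambda>p. \<exists>q\<in>phase_space. f p = Some q \<and> run fs q \<noteq> None)"
    by (intro generically_pullback) auto
  then show ?case
    by (rule generically_mono) auto
qed

lemma rational_involution_birational:
  assumes f: "rational_map f" and inv: "involution_on phase_space f"
  shows "birational f"
proof -
  have "generically (\<lambda>p. p \<in> dom f)"
  proof -
    obtain d where "polynomial_fun d" "\<exists>p\<in>phase_space. d p \<noteq> 0"
        "phase_space \<inter> dom f = {p \<in> phase_space. d p \<noteq> 0}"
      using f unfolding rational_map_def by (elim exE conjE)
    then show ?thesis
      unfolding generically_def by (intro exI[of _ d]) blast
  qed
  then have "(f \<circ>\<^sub>m f) \<approx> Some"
    unfolding rat_eq_iff_generically
  proof (rule generically_mono, goal_cases)
    case (1 p)
    then obtain q where "f p = Some q" "f q = Some p"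
      using inv unfolding involution_on_def by blast
    then show ?case by auto
  qed
  with f show ?thesis
    unfolding birational_def by blast
qed

text \<open>At a generic point both words are defined, with a common value \<open>q\<close>; running \<open>B\<close> backwards from \<open>q\<close>
  retraces the orbit, so the composite is automatically defined there and returns to the start.\<close>

lemma run_append_rev_is_identity:
  assumes bir: "\<And>f. f \<in> set A \<union> set B \<Longrightarrow> birational f"
    and inv: "\<And>f. f \<in> set A \<union> set B \<Longrightarrow> involution_on phase_space f"
    and eq: "\<And>p q r. p \<in> phase_space \<Longrightarrow> run A p = Some q \<Longrightarrow> run B p = Some r \<Longrightarrow> q = r"
  shows "run (A @ rev B) \<approx> Some"
proof -
  have "generically (\<lambda>p. run A p \<noteq> None \<and> run B p \<noteq> None)"
    using bir by (intro generically_conj generically_run_defined) auto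
  then have "generically (\<lambda>p. run (A @ rev B) p = Some p)"
  proof (rule generically_mono, goal_cases)
    case (1 p)
    then obtain q where q: "run A p = Some q" "run B p = Some q"
      using eq by fastforce
    then have "run (rev B) q = Some p"
      using run_rev_involutions[of B phase_space p q] inv 1(1) by auto
    with q show ?case by (simp add: run_append)
  qed
  then show ?thesis
    unfolding rat_eq_iff_generically by (rule generically_mono) auto
qed

lemma map_comp_assoc: "(f \<circ>\<^sub>m g) \<circ>\<^sub>m h = f \<circ>\<^sub>m (g \<circ>\<^sub>m h)"
  by (auto simp: map_comp_def fun_eq_iff split: option.splits)

lemma map_comp_Some_left [simp]: "Some \<circ>\<^sub>m f = f"
  and map_comp_Some_right [simp]: "f \<circ>\<^sub>m Some = f"
  by (auto simp: map_comp_def fun_eq_iff split: option.splits)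

definition birational_involution :: "(point \<rightharpoonup> point) \<Rightarrow> bool" where
  "birational_involution f \<longleftrightarrow> birational f \<and> involution_on phase_space f"

lemma involution_squared:
  assumes "birational_involution f"
  shows "map_power f 2 \<approx> Some"
  using run_append_rev_is_identity[of "[f]" "[f]"] assms
  by (simp add: birational_involution_def numeral_eq_Suc map_comp_assoc)

lemma coxeter_relation_2:
  assumes "birational_involution f" "birational_involution g"
    and "\<And>p q r. run [g, f] p = Some q \<Longrightarrow> run [f, g] p = Some r \<Longrightarrow> q = r"
  shows "map_power (f \<circ>\<^sub>m g) 2 \<approx> Some"
proof -
  have "run ([g, f] @ rev [f, g]) \<approx> Some"
    by (rule run_append_rev_is_identity)
      (use assms in \<open>auto simp: birational_involution_def simp del: run.simps\<close>)
  then show ?thesis by (simp add: numeral_eq_Suc map_comp_assoc)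
qed

lemma coxeter_relation_3:
  assumes "birational_involution f" "birational_involution g"
    and "\<And>p q r. run [g, f, g] p = Some q \<Longrightarrow> run [f, g, f] p = Some r \<Longrightarrow> q = r"
  shows "map_power (f \<circ>\<^sub>m g) 3 \<approx> Some"
proof -
  have "run ([g, f, g] @ rev [f, g, f]) \<approx> Some"
    by (rule run_append_rev_is_identity)
      (use assms in \<open>auto simp: birational_involution_def simp del: run.simps\<close>)
  then show ?thesis by (simp add: numeral_eq_Suc map_comp_assoc)
qed

lemma coxeter_relation_4:
  assumes "birational_involution f" "birational_involution g"
    and "\<And>p q r. run [g, f, g, f] p = Some q \<Longrightarrow> run [f, g, f, g] p = Some r \<Longrightarrow> q = r"
  shows "map_power (f \<circ>\<^sub>m g) 4 \<approx> Some"
proof -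
  have "run ([g, f, g, f] @ rev [f, g, f, g]) \<approx> Some"
    by (rule run_append_rev_is_identity)
      (use assms in \<open>auto simp: birational_involution_def simp del: run.simps\<close>)
  then show ?thesis by (simp add: numeral_eq_Suc map_comp_assoc)
qed

section \<open>The generators are birational involutions\<close>

lemma generator_eqs:
  "s0 p = (if pt_y p - 1 \<noteq> 0 then Some (Point (pt_x p + pt_a0 p / (pt_y p - 1)) (pt_y p) (pt_z p)
     (pt_w p) (pt_t p) (- pt_a0 p) (pt_a1 p) (pt_a2 p + pt_a0 p) (pt_a3 p) (pt_a4 p)) else None)"
  "s1 p = (if pt_y p \<noteq> 0 then Some (Point (pt_x p + pt_a1 p / pt_y p) (pt_y p) (pt_z p)
     (pt_w p) (pt_t p) (pt_a0 p) (- pt_a1 p) (pt_a2 p + pt_a1 p) (pt_a3 p) (pt_a4 p)) else None)"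
  "s2 p = (if pt_x p - pt_z p \<noteq> 0 then Some (Point (pt_x p) (pt_y p - pt_a2 p / (pt_x p - pt_z p))
     (pt_z p) (pt_w p + pt_a2 p / (pt_x p - pt_z p)) (pt_t p) (pt_a0 p + pt_a2 p)
     (pt_a1 p + pt_a2 p) (- pt_a2 p) (pt_a3 p + pt_a2 p) (pt_a4 p)) else None)"
  "s3 p = (if pt_w p \<noteq> 0 then Some (Point (pt_x p) (pt_y p) (pt_z p + pt_a3 p / pt_w p) (pt_w p)
     (pt_t p) (pt_a0 p) (pt_a1 p) (pt_a2 p + pt_a3 p) (- pt_a3 p) (pt_a4 p + pt_a3 p)) else None)"
  "s4 p = (if pt_z p \<noteq> 0 then Some (Point (pt_x p) (pt_y p) (pt_z p)
     (pt_w p - 2 * pt_a4 p / pt_z p + pt_t p / (pt_z p)^2) (- pt_t p) (pt_a0 p) (pt_a1 p) (pt_a2 p)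
     (pt_a3 p + 2 * pt_a4 p) (- pt_a4 p)) else None)"
  "pi1 p = Some (Point (- pt_x p) (1 - pt_y p) (- pt_z p) (- pt_w p) (- pt_t p)
     (pt_a1 p) (pt_a0 p) (pt_a2 p) (pt_a3 p) (pt_a4 p))"
  "pi2 p = (if pt_x p \<noteq> 0 \<and> pt_z p \<noteq> 0 \<and> pt_t p \<noteq> 0 then Some (Point (pt_t p / pt_z p)
     (- (pt_z p / pt_t p) * (pt_z p * pt_w p + pt_a3 p)) (pt_t p / pt_x p)
     (- (pt_x p / pt_t p) * (pt_x p * pt_y p + pt_a1 p)) (pt_t p) (2 * pt_a4 p + pt_a3 p) (pt_a3 p)
     (pt_a2 p) (pt_a1 p) ((pt_a0 p - pt_a1 p) / 2)) else None)"
  by (cases p; simp)+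

lemma Point_in_phase_space:
  "Point x y z w t a0 a1 a2 a3 a4 \<in> phase_space \<longleftrightarrow> a0 + a1 + 2 * a2 + 2 * a3 + 2 * a4 = 1"
  by (simp add: phase_space_def param_rel_def)

text \<open>The numerators are taken over one common denominator. That the image lies in the phase space is part
  of the map being an involution of it.\<close>

lemma rational_mapI:
  assumes "polynomial_fun d" "p0 \<in> phase_space" "d p0 \<noteq> 0"
    and n: "polynomial_fun nx" "polynomial_fun ny" "polynomial_fun nz" "polynomial_fun nw" "polynomial_fun nt"
      "polynomial_fun na0" "polynomial_fun na1" "polynomial_fun na2" "polynomial_fun na3" "polynomial_fun na4"
    and Some: "\<And>p. d p \<noteq> 0 \<Longrightarrow>
      f p = Some (Point (nx p / d p) (ny p / d p) (nz p / d p) (nw p / d p) (nt p / d p)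
            (na0 p / d p) (na1 p / d p) (na2 p / d p) (na3 p / d p) (na4 p / d p))"
    and None: "\<And>p. d p = 0 \<Longrightarrow> f p = None"
    and inv: "involution_on phase_space f"
  shows "rational_map f"
  unfolding rational_map_def
proof (rule exI[of _ d], intro conjI ballI)
  show "phase_space \<inter> dom f = {p \<in> phase_space. d p \<noteq> 0}"
  proof (rule set_eqI)
    fix p
    show "p \<in> phase_space \<inter> dom f \<longleftrightarrow> p \<in> {p \<in> phase_space. d p \<noteq> 0}"
      by (cases "d p = 0") (auto simp: Some None)
  qed
  show "\<forall>q. f p = Some q \<longrightarrow> q \<in> phase_space" if "p \<in> phase_space" for p
    using inv that unfolding involution_on_def by blast
  have eq: "q = Point (nx p / d p) (ny p / d p) (nz p / d p) (nw p / d p) (nt p / d p)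
            (na0 p / d p) (na1 p / d p) (na2 p / d p) (na3 p / d p) (na4 p / d p)"
    if "f p = Some q" for p q
    using Some[of p] None[of p] that by (cases "d p = 0") auto
  have numerator: "\<exists>n. polynomial_fun n \<and>
      (\<forall>p\<in>phase_space. \<forall>q. f p = Some q \<longrightarrow> c q = n p / d p)"
    if "polynomial_fun n" "\<And>p q. f p = Some q \<Longrightarrow> c q = n p / d p" for c n
    using that by blast
  fix c assume "c \<in> coords"
  then consider "c = pt_x" | "c = pt_y" | "c = pt_z" | "c = pt_w" | "c = pt_t" | "c = pt_a0"
    | "c = pt_a1" | "c = pt_a2" | "c = pt_a3" | "c = pt_a4"
    unfolding coords_def by blast
  then show "\<exists>n. polynomial_fun n \<and>
      (\<forall>p\<in>phase_space. \<forall>q. f p = Some q \<longrightarrow> c q = n p / d p)"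
    by cases (erule ssubst, rule numerator, rule n, drule eq, simp)+
qed (use assms in auto)

lemma involution_s0: "involution_on phase_space s0"
  and involution_s1: "involution_on phase_space s1"
  and involution_s2: "involution_on phase_space s2"
  and involution_s3: "involution_on phase_space s3"
  and involution_s4: "involution_on phase_space s4"
  and involution_pi1: "involution_on phase_space pi1"
  by (auto simp: involution_on_def generator_eqs phase_space_def param_rel_def algebra_simps
        split: if_splits intro!: point.expand)

lemma involution_pi2: "involution_on phase_space pi2"
  by (auto simp: involution_on_def generator_eqs phase_space_def param_rel_def
        split: if_splits intro!: point.expand) (simp_all add: field_simps, algebra)

lemma rational_s0: "rational_map s0"
  by (rule rational_mapI[where d = "\<lambda>p. pt_y p - 1" and ?p0.0 = "Point 0 0 0 0 0 1 0 0 0 0"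
      and nx = "\<lambda>p. pt_x p * (pt_y p - 1) + pt_a0 p"
      and ny = "\<lambda>p. pt_y p * (pt_y p - 1)"
      and nz = "\<lambda>p. pt_z p * (pt_y p - 1)"
      and nw = "\<lambda>p. pt_w p * (pt_y p - 1)"
      and nt = "\<lambda>p. pt_t p * (pt_y p - 1)"
      and ?na0.0 = "\<lambda>p. - pt_a0 p * (pt_y p - 1)"
      and ?na1.0 = "\<lambda>p. pt_a1 p * (pt_y p - 1)"
      and ?na2.0 = "\<lambda>p. (pt_a2 p + pt_a0 p) * (pt_y p - 1)"
      and ?na3.0 = "\<lambda>p. pt_a3 p * (pt_y p - 1)"
      and ?na4.0 = "\<lambda>p. pt_a4 p * (pt_y p - 1)"])
    (auto simp: generator_eqs involution_s0 Point_in_phase_space field_simps power2_eq_square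
      intro!: polynomial_fun_intros)

lemma rational_s1: "rational_map s1"
  by (rule rational_mapI[where d = "\<lambda>p. pt_y p" and ?p0.0 = "Point 0 1 0 0 0 1 0 0 0 0"
      and nx = "\<lambda>p. pt_x p * pt_y p + pt_a1 p"
      and ny = "\<lambda>p. pt_y p * pt_y p"
      and nz = "\<lambda>p. pt_z p * pt_y p"
      and nw = "\<lambda>p. pt_w p * pt_y p"
      and nt = "\<lambda>p. pt_t p * pt_y p"
      and ?na0.0 = "\<lambda>p. pt_a0 p * pt_y p"
      and ?na1.0 = "\<lambda>p. - pt_a1 p * pt_y p"
      and ?na2.0 = "\<lambda>p. (pt_a2 p + pt_a1 p) * pt_y p"
      and ?na3.0 = "\<lambda>p. pt_a3 p * pt_y p"
      and ?na4.0 = "\<lambda>p. pt_a4 p * pt_y p"])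
    (auto simp: generator_eqs involution_s1 Point_in_phase_space field_simps power2_eq_square
      intro!: polynomial_fun_intros)

lemma rational_s2: "rational_map s2"
  by (rule rational_mapI[where d = "\<lambda>p. pt_x p - pt_z p" and ?p0.0 = "Point 1 0 0 0 0 1 0 0 0 0"
      and nx = "\<lambda>p. pt_x p * (pt_x p - pt_z p)"
      and ny = "\<lambda>p. pt_y p * (pt_x p - pt_z p) - pt_a2 p"
      and nz = "\<lambda>p. pt_z p * (pt_x p - pt_z p)"
      and nw = "\<lambda>p. pt_w p * (pt_x p - pt_z p) + pt_a2 p"
      and nt = "\<lambda>p. pt_t p * (pt_x p - pt_z p)"
      and ?na0.0 = "\<lambda>p. (pt_a0 p + pt_a2 p) * (pt_x p - pt_z p)"
      and ?na1.0 = "\<lambda>p. (pt_a1 p + pt_a2 p) * (pt_x p - pt_z p)"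
      and ?na2.0 = "\<lambda>p. - pt_a2 p * (pt_x p - pt_z p)"
      and ?na3.0 = "\<lambda>p. (pt_a3 p + pt_a2 p) * (pt_x p - pt_z p)"
      and ?na4.0 = "\<lambda>p. pt_a4 p * (pt_x p - pt_z p)"])
    (auto simp: generator_eqs involution_s2 Point_in_phase_space field_simps power2_eq_square
      intro!: polynomial_fun_intros)

lemma rational_s3: "rational_map s3"
  by (rule rational_mapI[where d = "\<lambda>p. pt_w p" and ?p0.0 = "Point 0 0 0 1 0 1 0 0 0 0"
      and nx = "\<lambda>p. pt_x p * pt_w p"
      and ny = "\<lambda>p. pt_y p * pt_w p"
      and nz = "\<lambda>p. pt_z p * pt_w p + pt_a3 p"
      and nw = "\<lambda>p. pt_w p * pt_w p"
      and nt = "\<lambda>p. pt_t p * pt_w p"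
      and ?na0.0 = "\<lambda>p. pt_a0 p * pt_w p"
      and ?na1.0 = "\<lambda>p. pt_a1 p * pt_w p"
      and ?na2.0 = "\<lambda>p. (pt_a2 p + pt_a3 p) * pt_w p"
      and ?na3.0 = "\<lambda>p. - pt_a3 p * pt_w p"
      and ?na4.0 = "\<lambda>p. (pt_a4 p + pt_a3 p) * pt_w p"])
    (auto simp: generator_eqs involution_s3 Point_in_phase_space field_simps power2_eq_square
      intro!: polynomial_fun_intros)

lemma rational_s4: "rational_map s4"
  by (rule rational_mapI[where d = "\<lambda>p. (pt_z p)^2" and ?p0.0 = "Point 0 0 1 0 0 1 0 0 0 0"
      and nx = "\<lambda>p. pt_x p * (pt_z p)^2"
      and ny = "\<lambda>p. pt_y p * (pt_z p)^2"
      and nz = "\<lambda>p. pt_z p * (pt_z p)^2"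
      and nw = "\<lambda>p. pt_w p * pt_z p^2 - 2 * pt_a4 p * pt_z p + pt_t p"
      and nt = "\<lambda>p. - pt_t p * pt_z p^2"
      and ?na0.0 = "\<lambda>p. pt_a0 p * (pt_z p)^2"
      and ?na1.0 = "\<lambda>p. pt_a1 p * (pt_z p)^2"
      and ?na2.0 = "\<lambda>p. pt_a2 p * (pt_z p)^2"
      and ?na3.0 = "\<lambda>p. (pt_a3 p + 2 * pt_a4 p) * pt_z p^2"
      and ?na4.0 = "\<lambda>p. - pt_a4 p * pt_z p^2"])
    (auto simp: generator_eqs involution_s4 Point_in_phase_space field_simps power2_eq_square
      intro!: polynomial_fun_intros)

lemma rational_pi1: "rational_map pi1"
  by (rule rational_mapI[where d = "\<lambda>p. 1" and ?p0.0 = "Point 0 0 0 0 0 1 0 0 0 0"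
      and nx = "\<lambda>p. - pt_x p"
      and ny = "\<lambda>p. 1 - pt_y p"
      and nz = "\<lambda>p. - pt_z p"
      and nw = "\<lambda>p. - pt_w p"
      and nt = "\<lambda>p. - pt_t p"
      and ?na0.0 = "\<lambda>p. pt_a1 p"
      and ?na1.0 = "\<lambda>p. pt_a0 p"
      and ?na2.0 = "\<lambda>p. pt_a2 p"
      and ?na3.0 = "\<lambda>p. pt_a3 p"
      and ?na4.0 = "\<lambda>p. pt_a4 p"])
    (auto simp: generator_eqs involution_pi1 Point_in_phase_space field_simps power2_eq_square
      intro!: polynomial_fun_intros)

lemma rational_pi2: "rational_map pi2"
  by (rule rational_mapI[where d = "\<lambda>p. pt_x p * pt_z p * pt_t p" and ?p0.0 = "Point 1 0 1 0 1 1 0 0 0 0"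
      and nx = "\<lambda>p. (pt_t p)^2 * pt_x p"
      and ny = "\<lambda>p. - pt_x p * pt_z p^2 * (pt_z p * pt_w p + pt_a3 p)"
      and nz = "\<lambda>p. (pt_t p)^2 * pt_z p"
      and nw = "\<lambda>p. - (pt_x p * pt_x p) * pt_z p * (pt_x p * pt_y p + pt_a1 p)"
      and nt = "\<lambda>p. pt_t p * (pt_x p * pt_z p * pt_t p)"
      and ?na0.0 = "\<lambda>p. (2 * pt_a4 p + pt_a3 p) * (pt_x p * pt_z p * pt_t p)"
      and ?na1.0 = "\<lambda>p. pt_a3 p * (pt_x p * pt_z p * pt_t p)"
      and ?na2.0 = "\<lambda>p. pt_a2 p * (pt_x p * pt_z p * pt_t p)"
      and ?na3.0 = "\<lambda>p. pt_a1 p * (pt_x p * pt_z p * pt_t p)"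
      and ?na4.0 = "\<lambda>p. ((pt_a0 p - pt_a1 p) * (1 / 2)) * (pt_x p * pt_z p * pt_t p)"])
    (auto simp: generator_eqs involution_pi2 Point_in_phase_space field_simps power2_eq_square
      intro!: polynomial_fun_intros)

lemma birational_involution_generators:
  "birational_involution s0"
  "birational_involution s1"
  "birational_involution s2"
  "birational_involution s3"
  "birational_involution s4"
  "birational_involution pi1"
  "birational_involution pi2"
  unfolding birational_involution_def
  using rational_involution_birational
    rational_s0 rational_s1 rational_s2 rational_s3 rational_s4 rational_pi1 rational_pi2
    involution_s0 involution_s1 involution_s2 involution_s3
    involution_s4 involution_pi1 involution_pi2
  by blast+

lemmas birational_generators =
  birational_involution_generators[unfolded birational_involution_def, THEN conjunct1]

section \<open>The braid relations\<close>

text \<open>The reflections of type \<open>A\<^sub>2\<close> act on a pair by \<open>X \<mapsto> X + a / Y\<close> and \<open>Y \<mapsto> Y - b / X\<close>. Everything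
  factors through \<open>U = X Y + a\<close> and \<open>V = X Y - b\<close>: after both words the values are \<open>U X / V\<close> and
  \<open>V Y / U\<close>.\<close>

lemma braid_A2:
  fixes X Y a b :: "'a :: field"
  assumes "X \<noteq> 0" "Y \<noteq> 0" "X + a / Y \<noteq> 0" "Y - b / X \<noteq> 0"
  shows "X + a / Y + b / (Y - (a + b) / (X + a / Y)) = X + (a + b) / (Y - b / X)"
    and "(a + b) / (X + a / Y) = b / X + a / (X + (a + b) / (Y - b / X))"
proof -
  define U where "U = X * Y + a"
  define V where "V = X * Y - b"
  have 1: "X + a / Y = U / Y" "Y - b / X = V / X"
    using assms by (simp_all add: U_def V_def field_simps)
  with assms have nz: "U \<noteq> 0" "V \<noteq> 0" by auto
  have 2: "Y - (a + b) / (U / Y) = V * Y / U" "X + (a + b) / (V / X) = U * X / V"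
    using assms nz by (simp_all add: divide_simps) (simp_all add: U_def V_def algebra_simps)
  show "X + a / Y + b / (Y - (a + b) / (X + a / Y)) = X + (a + b) / (Y - b / X)"
    unfolding 1 2 using assms nz
    by (simp add: divide_simps) (simp add: U_def V_def algebra_simps)
  show "(a + b) / (X + a / Y) = b / X + a / (X + (a + b) / (Y - b / X))"
    unfolding 1 2 using assms nz
    by (simp add: divide_simps) (simp add: U_def V_def algebra_simps)
qed

text \<open>The same identities for \<open>- X\<close>, with \<open>X\<close> cancelled in the first. In this form they apply to \<open>s2\<close> and \<open>s3\<close>, where \<open>X = x - z\<close>
  decreases because \<open>s3\<close> shifts \<open>z\<close>.\<close>

lemma braid_A2_neg:
  fixes X Y a b :: "'a :: field"
  assumes "X \<noteq> 0" "Y \<noteq> 0" "X - a / Y \<noteq> 0" "Y + b / X \<noteq> 0"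
  shows "a / Y + b / (Y + (a + b) / (X - a / Y)) = (a + b) / (Y + b / X)"
    and "(a + b) / (X - a / Y) = b / X + a / (X - (a + b) / (Y + b / X))"
proof -
  have neg: "- X + c = - (X - c)" for c by simp
  have "- X \<noteq> 0" "- X + a / Y \<noteq> 0" "Y - b / - X \<noteq> 0"
    using assms by (auto simp: neg simp del: minus_diff_eq)
  note A2 = braid_A2[OF this(1) assms(2) this(2,3), unfolded neg divide_minus_right diff_minus_eq_add]
  show "a / Y + b / (Y + (a + b) / (X - a / Y)) = (a + b) / (Y + b / X)"
    using A2(1) by (simp add: algebra_simps)
  show "(a + b) / (X - a / Y) = b / X + a / (X - (a + b) / (Y + b / X))"
    using A2(2) by (simp only: minus_equation_iff minus_add_distrib[symmetric] neg_equal_iff_equal)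
qed

text \<open>The unprimed names follow the orbit of \<open>(z, w)\<close> under \<open>s3, s4, s3, s4\<close> and the primed ones
  under \<open>s4, s3, s4, s3\<close>; the coefficients record how \<open>\<alpha>\<^sub>3 = a\<close>, \<open>\<alpha>\<^sub>4 = e\<close> and \<open>t\<close> change on the
  way. All values are Laurent monomials in \<open>z\<close>, \<open>w\<close> and the four polynomials \<open>U, P, Q, R\<close> below, which are
  the factors that the successive steps create. Both orbits end at
  \<open>z = U R / Q\<close> and \<open>w = P Q / R\<^sup>2\<close>.\<close>

lemma braid_B2:
  fixes z w t a e :: "'a :: field"
  defines "z1 \<equiv> z + a / w"
  defines "w1 \<equiv> w - 2 * (e + a) / z1 + t / z1\<^sup>2"
  defines "z2 \<equiv> z1 + (a + 2 * e) / w1"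
  defines "w2 \<equiv> w1 - 2 * e / z2 - t / z2\<^sup>2"
  defines "w1' \<equiv> w - 2 * e / z + t / z\<^sup>2"
  defines "z1' \<equiv> z + (a + 2 * e) / w1'"
  defines "w2' \<equiv> w1' - 2 * (e + a) / z1' - t / z1'\<^sup>2"
  defines "z2' \<equiv> z1' + a / w2'"
  assumes nz: "w \<noteq> 0" "z \<noteq> 0" "z1 \<noteq> 0" "w1 \<noteq> 0" "z2 \<noteq> 0" "w1' \<noteq> 0" "z1' \<noteq> 0" "w2' \<noteq> 0"
  shows "z2 = z2'" "w2 = w2'"
proof -
  define U where "U = z * w + a"
  define P where "P = z\<^sup>2 * w - 2 * e * z + t"
  define Q where "Q = U * (z * w - a - 2 * e) + t * w"
  define R where "R = z * U + t"
  have z1: "z1 = U / w"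
    using nz by (simp add: z1_def U_def field_simps)
  with nz have U: "U \<noteq> 0" by auto
  have w1: "w1 = w * Q / U\<^sup>2"
    unfolding w1_def z1 using nz U
    by (simp add: divide_simps power2_eq_square) (simp add: Q_def U_def algebra_simps)
  with nz have Q: "Q \<noteq> 0" by auto
  have z2: "z2 = U * R / Q"
    unfolding z2_def w1 z1 using nz U Q
    by (simp add: divide_simps power2_eq_square) (simp add: Q_def R_def U_def algebra_simps)
  with nz have R: "R \<noteq> 0" by auto
  have w1': "w1' = P / z\<^sup>2"
    unfolding w1'_def using nz
    by (simp add: divide_simps power2_eq_square) (simp add: P_def power2_eq_square algebra_simps)
  with nz have P: "P \<noteq> 0" by auto
  have z1': "z1' = z * R / P"
    unfolding z1'_def w1' using nz P
    by (simp add: divide_simps power2_eq_square) (simp add: P_def R_def U_def power2_eq_square algebra_simps)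
  have "R\<^sup>2 - 2 * (e + a) * z * R - t * P = z\<^sup>2 * Q"
    unfolding P_def Q_def R_def U_def by algebra
  then have w2': "w2' = P * Q / R\<^sup>2"
    unfolding w2'_def w1' z1' using nz P R
    by (simp add: divide_simps power2_eq_square) algebra
  have zQ: "z * Q + a * R = U * P"
    unfolding P_def Q_def R_def U_def by algebra
  have z2': "z2' = U * R / Q"
    unfolding z2'_def w2' z1' using nz P Q R
    by (simp add: divide_simps power2_eq_square) (use zQ in algebra)
  have "w * R\<^sup>2 - 2 * e * U * R - t * Q = U\<^sup>2 * P"
    unfolding P_def Q_def R_def U_def by algebra
  then have "w2 = P * Q / R\<^sup>2"
    unfolding w2_def w1 z2 using nz U Q R
    by (simp add: divide_simps power2_eq_square) algebra
  with w2' show "w2 = w2'" by simp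
  from z2 z2' show "z2 = z2'" by simp
qed

lemma commute_s0_s1:
  "run [s1, s0] p = Some q \<Longrightarrow> run [s0, s1] p = Some r \<Longrightarrow> q = r"
  by (cases p) (auto simp: map_comp_Some_iff split: if_splits)

lemma commute_s0_s3:
  "run [s3, s0] p = Some q \<Longrightarrow> run [s0, s3] p = Some r \<Longrightarrow> q = r"
  by (cases p) (auto simp: map_comp_Some_iff split: if_splits)

lemma commute_s0_s4:
  "run [s4, s0] p = Some q \<Longrightarrow> run [s0, s4] p = Some r \<Longrightarrow> q = r"
  by (cases p) (auto simp: map_comp_Some_iff split: if_splits)

lemma commute_s1_s3:
  "run [s3, s1] p = Some q \<Longrightarrow> run [s1, s3] p = Some r \<Longrightarrow> q = r"
  by (cases p) (auto simp: map_comp_Some_iff split: if_splits)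

lemma commute_s1_s4:
  "run [s4, s1] p = Some q \<Longrightarrow> run [s1, s4] p = Some r \<Longrightarrow> q = r"
  by (cases p) (auto simp: map_comp_Some_iff split: if_splits)

lemma commute_s2_s4:
  "run [s4, s2] p = Some q \<Longrightarrow> run [s2, s4] p = Some r \<Longrightarrow> q = r"
  by (cases p) (auto simp: map_comp_Some_iff split: if_splits simp: algebra_simps)

lemma braid_s0_s2:
  assumes "run [s2, s0, s2] p = Some q" "run [s0, s2, s0] p = Some r"
  shows "q = r"
proof (cases p)
  case (Point x y z w t a0 a1 a2 a3 a4)
  show ?thesis
    using assms braid_A2[of "x - z" "y - 1" a0 a2] unfolding Point
    by (auto simp: map_comp_Some_iff split: if_splits simp: algebra_simps)
qed

lemma braid_s1_s2:
  assumes "run [s2, s1, s2] p = Some q" "run [s1, s2, s1] p = Some r"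
  shows "q = r"
proof (cases p)
  case (Point x y z w t a0 a1 a2 a3 a4)
  show ?thesis
    using assms braid_A2[of "x - z" "y" a1 a2] unfolding Point
    by (auto simp: map_comp_Some_iff split: if_splits simp: algebra_simps)
qed

lemma braid_s2_s3:
  assumes "run [s3, s2, s3] p = Some q" "run [s2, s3, s2] p = Some r"
  shows "q = r"
proof (cases p)
  case (Point x y z w t a0 a1 a2 a3 a4)
  show ?thesis
    using assms braid_A2_neg[of "x - z" w a3 a2] unfolding Point
    by (auto simp: map_comp_Some_iff split: if_splits simp: algebra_simps)
qed

lemma braid_s3_s4:
  assumes "run [s4, s3, s4, s3] p = Some q" "run [s3, s4, s3, s4] p = Some r"
  shows "q = r"
proof (cases p)
  case (Point x y z w t a e a2 a3 a4)
  show ?thesis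
    using assms braid_B2[of w z a3 a4 t] unfolding Point
    by (auto simp: map_comp_Some_iff split: if_splits simp: algebra_simps)
qed

section \<open>Solutions are transformed into solutions\<close>

text \<open>Complex differentiability at every point of an open set gives holomorphy, so only derivatives have
  to be computed. The transformed independent variable is \<open>t\<close> or \<open>- t\<close>, hence a constant derivative
  \<open>e\<close> is general enough.\<close>

lemma solvesI:
  assumes "open D" "param_rel a0 a1 a2 a3 a4" "e \<noteq> 0"
    and "\<And>s. s \<in> D \<Longrightarrow> T s \<noteq> 0"
    and "\<And>s. s \<in> D \<Longrightarrow> (T has_field_derivative e) (at s)"
    and "\<And>s. s \<in> D \<Longrightarrow> (X has_field_derivative
           e * rhs_x (Point (X s) (Y s) (Z s) (W s) (T s) a0 a1 a2 a3 a4)) (at s)"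
    and "\<And>s. s \<in> D \<Longrightarrow> (Y has_field_derivative
           e * rhs_y (Point (X s) (Y s) (Z s) (W s) (T s) a0 a1 a2 a3 a4)) (at s)"
    and "\<And>s. s \<in> D \<Longrightarrow> (Z has_field_derivative
           e * rhs_z (Point (X s) (Y s) (Z s) (W s) (T s) a0 a1 a2 a3 a4)) (at s)"
    and "\<And>s. s \<in> D \<Longrightarrow> (W has_field_derivative
           e * rhs_w (Point (X s) (Y s) (Z s) (W s) (T s) a0 a1 a2 a3 a4)) (at s)"
  shows "solves D X Y Z W T a0 a1 a2 a3 a4"
proof -
  have hol: "f holomorphic_on D" if "\<And>s. s \<in> D \<Longrightarrow> (f has_field_derivative f' s) (at s)" for f f'
    using that holomorphic_on_open[OF assms(1)] by blast
  show ?thesis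
    unfolding solves_def Let_def
    using assms(1-4)
    by (auto intro!: hol assms(5-9)
          simp: DERIV_imp_deriv[OF assms(5)] DERIV_imp_deriv[OF assms(6)] DERIV_imp_deriv[OF assms(7)]
            DERIV_imp_deriv[OF assms(8)] DERIV_imp_deriv[OF assms(9)])
qed

text \<open>Here the definition of a solution is unpacked into derivative rules for the four components, with
  the independent variable as the parameter of the curve.\<close>

lemma baecklundI:
  assumes "birational f"
    and "\<And>D X Y Z W a0 a1 a2 a3 a4.
       \<lbrakk>open D; a0 + a1 + 2 * a2 + 2 * a3 + 2 * a4 = 1; \<And>t. t \<in> D \<Longrightarrow> t \<noteq> 0;
        \<And>t. t \<in> D \<Longrightarrow> (X has_field_derivative rhs_x (Point (X t) (Y t) (Z t) (W t) t a0 a1 a2 a3 a4)) (at t);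
        \<And>t. t \<in> D \<Longrightarrow> (Y has_field_derivative rhs_y (Point (X t) (Y t) (Z t) (W t) t a0 a1 a2 a3 a4)) (at t);
        \<And>t. t \<in> D \<Longrightarrow> (Z has_field_derivative rhs_z (Point (X t) (Y t) (Z t) (W t) t a0 a1 a2 a3 a4)) (at t);
        \<And>t. t \<in> D \<Longrightarrow> (W has_field_derivative rhs_w (Point (X t) (Y t) (Z t) (W t) t a0 a1 a2 a3 a4)) (at t);
        \<And>t. t \<in> D \<Longrightarrow> f (Point (X t) (Y t) (Z t) (W t) t a0 a1 a2 a3 a4) \<noteq> None\<rbrakk> \<Longrightarrow>
       \<exists>X' Y' Z' W' T' b0 b1 b2 b3 b4.
          (\<forall>t\<in>D. f (Point (X t) (Y t) (Z t) (W t) t a0 a1 a2 a3 a4) =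
                  Some (Point (X' t) (Y' t) (Z' t) (W' t) (T' t) b0 b1 b2 b3 b4)) \<and>
          solves D X' Y' Z' W' T' b0 b1 b2 b3 b4"
  shows "baecklund f"
  unfolding baecklund_def
proof (intro conjI allI impI assms(1))
  fix D X Y Z W a0 a1 a2 a3 a4
  assume sol: "solves D X Y Z W (\<lambda>t. t) a0 a1 a2 a3 a4"
    and dom: "\<forall>t\<in>D. Point (X t) (Y t) (Z t) (W t) t a0 a1 a2 a3 a4 \<in> dom f"
  have der: "(g has_field_derivative deriv g t) (at t)" if "g holomorphic_on D" "t \<in> D" for g t
    using that sol unfolding solves_def by (meson holomorphic_derivI)
  show "\<exists>X' Y' Z' W' T' b0 b1 b2 b3 b4.
          (\<forall>t\<in>D. f (Point (X t) (Y t) (Z t) (W t) t a0 a1 a2 a3 a4) =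
                  Some (Point (X' t) (Y' t) (Z' t) (W' t) (T' t) b0 b1 b2 b3 b4)) \<and>
          solves D X' Y' Z' W' T' b0 b1 b2 b3 b4"
  proof (rule assms(2))
    show "f (Point (X t) (Y t) (Z t) (W t) t a0 a1 a2 a3 a4) \<noteq> None" if "t \<in> D" for t
      using dom that by blast
  qed (use sol der[of X] der[of Y] der[of Z] der[of W] in
       \<open>simp_all add: solves_def Let_def param_rel_def del: rhs_x.simps rhs_y.simps rhs_z.simps rhs_w.simps\<close>)
qed

lemma transformed_solutionI:
  assumes "open D" "e \<noteq> 0" "param_rel b0 b1 b2 b3 b4"
    and "\<And>t. t \<in> D \<Longrightarrow>
      f (Point (X t) (Y t) (Z t) (W t) t a0 a1 a2 a3 a4) =
        Some (Point (X' t) (Y' t) (Z' t) (W' t) (T' t) b0 b1 b2 b3 b4) \<and>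
      T' t \<noteq> 0 \<and> (T' has_field_derivative e) (at t) \<and>
      (X' has_field_derivative
        e * rhs_x (Point (X' t) (Y' t) (Z' t) (W' t) (T' t) b0 b1 b2 b3 b4)) (at t) \<and>
      (Y' has_field_derivative
        e * rhs_y (Point (X' t) (Y' t) (Z' t) (W' t) (T' t) b0 b1 b2 b3 b4)) (at t) \<and>
      (Z' has_field_derivative
        e * rhs_z (Point (X' t) (Y' t) (Z' t) (W' t) (T' t) b0 b1 b2 b3 b4)) (at t) \<and>
      (W' has_field_derivative
        e * rhs_w (Point (X' t) (Y' t) (Z' t) (W' t) (T' t) b0 b1 b2 b3 b4)) (at t)"
  shows "\<exists>X' Y' Z' W' T' b0 b1 b2 b3 b4.
    (\<forall>t\<in>D. f (Point (X t) (Y t) (Z t) (W t) t a0 a1 a2 a3 a4) =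
            Some (Point (X' t) (Y' t) (Z' t) (W' t) (T' t) b0 b1 b2 b3 b4)) \<and>
    solves D X' Y' Z' W' T' b0 b1 b2 b3 b4"
proof (intro exI conjI ballI)
  show "solves D X' Y' Z' W' T' b0 b1 b2 b3 b4"
    using assms(4) by (intro solvesI[OF assms(1,3,2)]) blast+
  show "f (Point (X t) (Y t) (Z t) (W t) t a0 a1 a2 a3 a4) =
          Some (Point (X' t) (Y' t) (Z' t) (W' t) (T' t) b0 b1 b2 b3 b4)" if "t \<in> D" for t
    using assms(4)[OF that] by blast
qed

text \<open>Each transformed component is differentiated along the curve. Clearing denominators leaves a
  polynomial identity; \<open>s4\<close> and \<open>pi2\<close> move \<open>t\<close> into the dependent variables, and there the identity
  holds only modulo the parameter relation, which enters by eliminating \<open>\<alpha>\<^sub>0\<close>.\<close>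

lemma baecklund_s0: "baecklund s0"
proof (rule baecklundI, goal_cases)
  case 1 show ?case by (rule birational_generators)
next
  case curve: (2 D X Y Z W a0 a1 a2 a3 a4)
  show ?case
  proof (rule transformed_solutionI[OF curve(1), where e = "1"
      and X' = "\<lambda>t. X t + a0 / (Y t - 1)" and Y' = Y
      and Z' = Z and W' = W
      and T' = "\<lambda>t. t"
      and ?b0.0 = "- a0" and ?b1.0 = a1 and ?b2.0 = "a2 + a0" and ?b3.0 = a3 and ?b4.0 = a4],
      goal_cases)
    case 1 show ?case by simp
  next
    case 2 show ?case using curve(2) unfolding param_rel_def by algebra
  next
    case (3 t)
    note derivs = curve(4-7)[OF 3, unfolded rhs_x.simps rhs_y.simps rhs_z.simps rhs_w.simps]
    have nz: "Y t - 1 \<noteq> 0" "t \<noteq> 0"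
      using curve(3,8)[OF 3] by (auto split: if_splits)
    show ?case
      by (intro conjI, (insert nz, simp)[1], simp add: nz, (auto intro!: derivative_eq_intros)[1])
        ((rule DERIV_cong, (rule derivs derivative_intros nz | (simp add: nz; fail))+, (insert nz)?,
          (simp add: divide_simps power2_eq_square)?, (simp add: algebra_simps)?)[1])+
  qed
qed

lemma baecklund_s1: "baecklund s1"
proof (rule baecklundI, goal_cases)
  case 1 show ?case by (rule birational_generators)
next
  case curve: (2 D X Y Z W a0 a1 a2 a3 a4)
  show ?case
  proof (rule transformed_solutionI[OF curve(1), where e = "1"
      and X' = "\<lambda>t. X t + a1 / Y t" and Y' = Y
      and Z' = Z and W' = W
      and T' = "\<lambda>t. t"
      and ?b0.0 = a0 and ?b1.0 = "- a1" and ?b2.0 = "a2 + a1" and ?b3.0 = a3 and ?b4.0 = a4],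
      goal_cases)
    case 1 show ?case by simp
  next
    case 2 show ?case using curve(2) unfolding param_rel_def by algebra
  next
    case (3 t)
    note derivs = curve(4-7)[OF 3, unfolded rhs_x.simps rhs_y.simps rhs_z.simps rhs_w.simps]
    have nz: "Y t \<noteq> 0" "t \<noteq> 0"
      using curve(3,8)[OF 3] by (auto split: if_splits)
    show ?case
      by (intro conjI, (insert nz, simp)[1], simp add: nz, (auto intro!: derivative_eq_intros)[1])
        ((rule DERIV_cong, (rule derivs derivative_intros nz | (simp add: nz; fail))+, (insert nz)?,
          (simp add: divide_simps power2_eq_square)?, (simp add: algebra_simps)?)[1])+
  qed
qed

lemma baecklund_s2: "baecklund s2"
proof (rule baecklundI, goal_cases)
  case 1 show ?case by (rule birational_generators)
next
  case curve: (2 D X Y Z W a0 a1 a2 a3 a4)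
  show ?case
  proof (rule transformed_solutionI[OF curve(1), where e = "1"
      and X' = X and Y' = "\<lambda>t. Y t - a2 / (X t - Z t)"
      and Z' = Z and W' = "\<lambda>t. W t + a2 / (X t - Z t)"
      and T' = "\<lambda>t. t"
      and ?b0.0 = "a0 + a2" and ?b1.0 = "a1 + a2" and ?b2.0 = "- a2" and ?b3.0 = "a3 + a2" and ?b4.0 = a4],
      goal_cases)
    case 1 show ?case by simp
  next
    case 2 show ?case using curve(2) unfolding param_rel_def by algebra
  next
    case (3 t)
    note derivs = curve(4-7)[OF 3, unfolded rhs_x.simps rhs_y.simps rhs_z.simps rhs_w.simps]
    have nz: "X t - Z t \<noteq> 0" "t \<noteq> 0"
      using curve(3,8)[OF 3] by (auto split: if_splits)
    show ?case
      by (intro conjI, (insert nz, simp)[1], simp add: nz, (auto intro!: derivative_eq_intros)[1])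
        ((rule DERIV_cong, (rule derivs derivative_intros nz | (simp add: nz; fail))+, (insert nz)?,
          (simp add: divide_simps power2_eq_square)?, (simp add: algebra_simps)?)[1])+
  qed
qed

lemma baecklund_s3: "baecklund s3"
proof (rule baecklundI, goal_cases)
  case 1 show ?case by (rule birational_generators)
next
  case curve: (2 D X Y Z W a0 a1 a2 a3 a4)
  show ?case
  proof (rule transformed_solutionI[OF curve(1), where e = "1"
      and X' = X and Y' = Y
      and Z' = "\<lambda>t. Z t + a3 / W t" and W' = W
      and T' = "\<lambda>t. t"
      and ?b0.0 = a0 and ?b1.0 = a1 and ?b2.0 = "a2 + a3" and ?b3.0 = "- a3" and ?b4.0 = "a4 + a3"],
      goal_cases)
    case 1 show ?case by simp
  next
    case 2 show ?case using curve(2) unfolding param_rel_def by algebra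
  next
    case (3 t)
    note derivs = curve(4-7)[OF 3, unfolded rhs_x.simps rhs_y.simps rhs_z.simps rhs_w.simps]
    have nz: "W t \<noteq> 0" "t \<noteq> 0"
      using curve(3,8)[OF 3] by (auto split: if_splits)
    show ?case
      by (intro conjI, (insert nz, simp)[1], simp add: nz, (auto intro!: derivative_eq_intros)[1])
        ((rule DERIV_cong, (rule derivs derivative_intros nz | (simp add: nz; fail))+, (insert nz)?,
          (simp add: divide_simps power2_eq_square)?, (simp add: algebra_simps)?)[1])+
  qed
qed

lemma baecklund_s4: "baecklund s4"
proof (rule baecklundI, goal_cases)
  case 1 show ?case by (rule birational_generators)
next
  case curve: (2 D X Y Z W a0 a1 a2 a3 a4)
  show ?case
  proof (rule transformed_solutionI[OF curve(1), where e = "- 1"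
      and X' = X and Y' = Y
      and Z' = Z and W' = "\<lambda>t. W t - 2 * a4 / Z t + t / (Z t)^2"
      and T' = "\<lambda>t. - t"
      and ?b0.0 = a0 and ?b1.0 = a1 and ?b2.0 = a2 and ?b3.0 = "a3 + 2 * a4" and ?b4.0 = "- a4"],
      goal_cases)
    case 1 show ?case by simp
  next
    case 2 show ?case using curve(2) unfolding param_rel_def by algebra
  next
    case (3 t)
    note derivs = curve(4-7)[OF 3, unfolded rhs_x.simps rhs_y.simps rhs_z.simps rhs_w.simps]
    have nz: "Z t \<noteq> 0" "t \<noteq> 0"
      using curve(3,8)[OF 3] by (auto split: if_splits)
    have a0: "a0 = 1 - a1 - 2 * a2 - 2 * a3 - 2 * a4"
      using curve(2) by algebra
    show ?case
      by (intro conjI, (insert nz, simp)[1], simp add: nz, (auto intro!: derivative_eq_intros)[1])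
        ((rule DERIV_cong, (rule derivs derivative_intros nz | (simp add: nz; fail))+, (insert nz)?,
          (simp add: divide_simps power2_eq_square)?, (simp add: a0 algebra_simps)?)[1])+
  qed
qed

lemma baecklund_pi1: "baecklund pi1"
proof (rule baecklundI, goal_cases)
  case 1 show ?case by (rule birational_generators)
next
  case curve: (2 D X Y Z W a0 a1 a2 a3 a4)
  show ?case
  proof (rule transformed_solutionI[OF curve(1), where e = "- 1"
      and X' = "\<lambda>t. - X t" and Y' = "\<lambda>t. 1 - Y t"
      and Z' = "\<lambda>t. - Z t" and W' = "\<lambda>t. - W t"
      and T' = "\<lambda>t. - t"
      and ?b0.0 = a1 and ?b1.0 = a0 and ?b2.0 = a2 and ?b3.0 = a3 and ?b4.0 = a4],
      goal_cases)
    case 1 show ?case by simp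
  next
    case 2 show ?case using curve(2) unfolding param_rel_def by algebra
  next
    case (3 t)
    note derivs = curve(4-7)[OF 3, unfolded rhs_x.simps rhs_y.simps rhs_z.simps rhs_w.simps]
    have nz: "t \<noteq> 0"
      using curve(3,8)[OF 3] by (auto split: if_splits)
    show ?case
      by (intro conjI, (insert nz, simp)[1], simp add: nz, (auto intro!: derivative_eq_intros)[1])
        ((rule DERIV_cong, (rule derivs derivative_intros nz | (simp add: nz; fail))+, (insert nz)?,
          (simp add: divide_simps power2_eq_square)?, (simp add: algebra_simps)?)[1])+
  qed
qed

lemma baecklund_pi2: "baecklund pi2"
proof (rule baecklundI, goal_cases)
  case 1 show ?case by (rule birational_generators)
next
  case curve: (2 D X Y Z W a0 a1 a2 a3 a4)
  show ?case
  proof (rule transformed_solutionI[OF curve(1), where e = "1"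
      and X' = "\<lambda>t. t / Z t" and Y' = "\<lambda>t. - (Z t / t) * (Z t * W t + a3)"
      and Z' = "\<lambda>t. t / X t" and W' = "\<lambda>t. - (X t / t) * (X t * Y t + a1)"
      and T' = "\<lambda>t. t"
      and ?b0.0 = "2 * a4 + a3" and ?b1.0 = a3 and ?b2.0 = a2 and ?b3.0 = a1 and ?b4.0 = "(a0 - a1) / 2"],
      goal_cases)
    case 1 show ?case by simp
  next
    case 2 show ?case using curve(2) unfolding param_rel_def by algebra
  next
    case (3 t)
    note derivs = curve(4-7)[OF 3, unfolded rhs_x.simps rhs_y.simps rhs_z.simps rhs_w.simps]
    have nz: "X t \<noteq> 0" "Z t \<noteq> 0" "t \<noteq> 0"
      using curve(3,8)[OF 3] by (auto split: if_splits)
    have a0: "a0 = 1 - a1 - 2 * a2 - 2 * a3 - 2 * a4"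
      using curve(2) by algebra
    show ?case
      by (intro conjI, (insert nz, simp)[1], simp add: nz, (auto intro!: derivative_eq_intros)[1])
        ((rule DERIV_cong, (rule derivs derivative_intros nz | (simp add: nz; fail))+, (insert nz)?,
          (simp add: divide_simps power2_eq_square)?, (simp add: a0 algebra_simps)?)[1])+
  qed
qed

section \<open>The extended affine Weyl group symmetry\<close>

theorem theorem3p1:
  shows
    "(\<forall>f \<in> {s0, s1, s2, s3, s4, pi1, pi2}. baecklund f) \<and>
     (\<forall>f \<in> {s0, s1, s2, s3, s4}. map_power f 2 \<approx> Some) \<and>
     map_power pi1 2 \<approx> Some \<and>
     map_power pi2 2 \<approx> Some \<and>
     map_power (s0 \<circ>\<^sub>m s1) 2 \<approx> Some \<and>
     map_power (s0 \<circ>\<^sub>m s3) 2 \<approx> Some \<and>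
     map_power (s0 \<circ>\<^sub>m s4) 2 \<approx> Some \<and>
     map_power (s1 \<circ>\<^sub>m s3) 2 \<approx> Some \<and>
     map_power (s1 \<circ>\<^sub>m s4) 2 \<approx> Some \<and>
     map_power (s2 \<circ>\<^sub>m s4) 2 \<approx> Some \<and>
     map_power (s0 \<circ>\<^sub>m s2) 3 \<approx> Some \<and>
     map_power (s1 \<circ>\<^sub>m s2) 3 \<approx> Some \<and>
     map_power (s2 \<circ>\<^sub>m s3) 3 \<approx> Some \<and>
     map_power (s3 \<circ>\<^sub>m s4) 4 \<approx> Some"
proof (intro conjI)
  show "\<forall>f \<in> {s0, s1, s2, s3, s4, pi1, pi2}. baecklund f"
    by (auto intro: baecklund_s0 baecklund_s1 baecklund_s2 baecklund_s3 baecklund_s4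
        baecklund_pi1 baecklund_pi2)
  show "\<forall>f \<in> {s0, s1, s2, s3, s4}. map_power f 2 \<approx> Some"
    by (auto intro!: involution_squared birational_involution_generators)
qed (rule involution_squared coxeter_relation_2 coxeter_relation_3 coxeter_relation_4;
     (rule birational_involution_generators)?;
     (erule (1) commute_s0_s1 commute_s0_s3 commute_s0_s4 commute_s1_s3 commute_s1_s4 commute_s2_s4
        braid_s0_s2 braid_s1_s2 braid_s2_s3 braid_s3_s4)?)+

end
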